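(* Let $L$ be a nonempty set and let $X, Y \subseteq L$. Define $C(X,Y)\colon \mathcal P(L)\to\mathcal P(L)$ by: for $A\subseteq L$, $C(X,Y)(A)=A\cup X$ if $A\cap Y\neq\emptyset$, and $C(X,Y)(A)=A$ if $A\cap Y=\emptyset$. Define $C'(X,Y)\colon \mathcal P(L)\to\mathcal P(L)$ by: $C'(X,Y)(A)=A\cup X$ if $Y\subseteq A$, and $C'(X,Y)(A)=A$ if $Y\not\subseteq A$. Then $C(X,Y)$ is a finite consequence operator on $L$ and $C'(X,Y)$ is a consequence operator on $L$. If moreover $Y$ is finite, then $C'(X,Y)$ is a finite consequence operator.
   Context: A consequence operator on a nonempty set $L$ is a map $C\colon\mathcal P(L)\to\mathcal P(L)$ such that for all $X,Y\subseteq L$: (i) $X\subseteq C(X)=C(C(X))\subseteq L$, and (ii) if $X\subseteq Y$ then $C(X)\subseteq C(Y)$. It is finite (finitary, algebraic) if in addition (iii) $C(X)=\bigcup\{C(A): A \text{ a finite subset of } X\}$ for every $X\subseteq L$ (the empty set counts as finite). *)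

theory Defs
  imports Main "HOL-Library.FuncSet"
begin

text \<open>
  The set \<open>L\<close> is an explicit carrier, so that it is an arbitrary set and not a whole type.
  A map from the subsets of \<open>L\<close> to the subsets of \<open>L\<close> is a function on \<open>'a set\<close> that sends
  \<open>Pow L\<close> into \<open>Pow L\<close>; its values outside \<open>Pow L\<close> are unconstrained and irrelevant.
\<close>

definition consequence_operator :: "'a set \<Rightarrow> ('a set \<Rightarrow> 'a set) \<Rightarrow> bool" where
  "consequence_operator L C \<longleftrightarrow>
     L \<noteq> {} \<and> C \<in> Pow L \<rightarrow> Pow L \<and>
     (\<forall>X. X \<subseteq> L \<longrightarrow> X \<subseteq> C X \<and> C X = C (C X) \<and> C X \<subseteq> L) \<and>
     (\<forall>X Y. X \<subseteq> L \<and> Y \<subseteq> L \<and> X \<subseteq> Y \<longrightarrow> C X \<subseteq> C Y)"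

definition finite_consequence_operator :: "'a set \<Rightarrow> ('a set \<Rightarrow> 'a set) \<Rightarrow> bool" where
  "finite_consequence_operator L C \<longleftrightarrow>
     consequence_operator L C \<and>
     (\<forall>X. X \<subseteq> L \<longrightarrow> C X = \<Union> {C A | A. finite A \<and> A \<subseteq> X})"

definition C_meet :: "'a set \<Rightarrow> 'a set \<Rightarrow> 'a set \<Rightarrow> 'a set" where
  "C_meet X Y A = (if A \<inter> Y \<noteq> {} then A \<union> X else A)"

definition C_sub :: "'a set \<Rightarrow> 'a set \<Rightarrow> 'a set \<Rightarrow> 'a set" where
  "C_sub X Y A = (if Y \<subseteq> A then A \<union> X else A)"

end

theory Submission
  imports Defs
begin

text \<open>Both operators add the fixed set \<open>X\<close> as soon as a trigger condition on the
  argument holds: meeting \<open>Y\<close>, or containing \<open>Y\<close>. Either condition passes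
  to supersets. This gives monotonicity, and also idempotence: once triggered, the enlarged set
  still satisfies the condition and \<open>X\<close> is already there. Finitarity asks that a
  triggered set have a finite triggered subset: a single common point with \<open>Y\<close> serves
  for \<open>C_meet\<close>, and \<open>Y\<close> itself, when finite, for
  \<open>C_sub\<close>.\<close>

text \<open>Monotonicity already gives one inclusion of the finitary equation, so what remains is to
  trace each point of \<open>C Z\<close> back to a finite subset of \<open>Z\<close>.\<close>

lemma finite_consequence_operatorI:
  assumes C: "consequence_operator L C"
    and fin: "\<And>Z z. Z \<subseteq> L \<Longrightarrow> z \<in> C Z \<Longrightarrow> \<exists>A. finite A \<and> A \<subseteq> Z \<and> z \<in> C A"
  shows "finite_consequence_operator L C"
  unfolding finite_consequence_operator_def
proof (intro conjI allI impI C)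
  fix Z assume Z: "Z \<subseteq> L"
  have "C A \<subseteq> C Z" if "A \<subseteq> Z" for A
  proof -
    have "A \<subseteq> L" using that Z by (rule subset_trans)
    with C Z that show ?thesis
      by (simp add: consequence_operator_def)
  qed
  then have "\<Union> {C A | A. finite A \<and> A \<subseteq> Z} \<subseteq> C Z"
    by (auto dest: subsetD)
  moreover have "C Z \<subseteq> \<Union> {C A | A. finite A \<and> A \<subseteq> Z}"
  proof
    fix z assume "z \<in> C Z"
    from fin[OF Z this] show "z \<in> \<Union> {C A | A. finite A \<and> A \<subseteq> Z}"
      by auto
  qed
  ultimately show "C Z = \<Union> {C A | A. finite A \<and> A \<subseteq> Z}"
    by (rule equalityI[rotated])
qed

text \<open>Meeting \<open>Y\<close> is inherited by supersets, so a case split on this condition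
  settles idempotence and monotonicity; \<open>X \<subseteq> L\<close> keeps the values inside
  \<open>L\<close>.\<close>

lemma consequence_operator_C_meet:
  assumes "L \<noteq> {}" and "X \<subseteq> L"
  shows "consequence_operator L (C_meet X Y)"
proof -
  have "Z \<subseteq> C_meet X Y Z" for Z
    by (auto simp: C_meet_def)
  moreover have "C_meet X Y (C_meet X Y Z) = C_meet X Y Z" for Z
    unfolding C_meet_def by (cases "Z \<inter> Y = {}") auto
  moreover have "C_meet X Y Z \<subseteq> L" if "Z \<subseteq> L" for Z
    using that assms(2) by (simp add: C_meet_def)
  moreover have "C_meet X Y Z \<subseteq> C_meet X Y W" if "Z \<subseteq> W" for Z W
    using that unfolding C_meet_def by (cases "Z \<inter> Y = {}"; cases "W \<inter> Y = {}") auto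
  ultimately show ?thesis
    using assms(1) unfolding consequence_operator_def by (simp add: Pi_iff)
qed

text \<open>The same argument works because containing \<open>Y\<close> is also inherited by
  supersets.\<close>

lemma consequence_operator_C_sub:
  assumes "L \<noteq> {}" and "X \<subseteq> L"
  shows "consequence_operator L (C_sub X Y)"
proof -
  have "Z \<subseteq> C_sub X Y Z" for Z
    by (auto simp: C_sub_def)
  moreover have "C_sub X Y (C_sub X Y Z) = C_sub X Y Z" for Z
    unfolding C_sub_def by (cases "Y \<subseteq> Z") auto
  moreover have "C_sub X Y Z \<subseteq> L" if "Z \<subseteq> L" for Z
    using that assms(2) by (simp add: C_sub_def)
  moreover have "C_sub X Y Z \<subseteq> C_sub X Y W" if "Z \<subseteq> W" for Z W
    using that unfolding C_sub_def by (cases "Y \<subseteq> Z"; cases "Y \<subseteq> W") auto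
  ultimately show ?thesis
    using assms(1) unfolding consequence_operator_def by (simp add: Pi_iff)
qed

lemma finite_consequence_operator_C_meet:
  assumes "L \<noteq> {}" and "X \<subseteq> L"
  shows "finite_consequence_operator L (C_meet X Y)"
proof (rule finite_consequence_operatorI[OF consequence_operator_C_meet[OF assms]])
  fix Z z assume z: "z \<in> C_meet X Y Z"
  show "\<exists>A. finite A \<and> A \<subseteq> Z \<and> z \<in> C_meet X Y A"
  proof (cases "z \<in> Z")
    case True
    then show ?thesis
      \<comment> \<open>Whether or not \<open>{z}\<close> triggers the addition of \<open>X\<close>,
        its image contains \<open>z\<close>.\<close>
      by (intro exI[of _ "{z}"]) (auto simp: C_meet_def)
  next
    case False
    \<comment> \<open>A point outside \<open>Z\<close> can only come from \<open>X\<close>, so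
      \<open>Z\<close> was triggered by some \<open>y\<close>; the singleton \<open>{y}\<close>
      triggers as well.\<close>
    with z obtain y where "y \<in> Z" "y \<in> Y" "z \<in> X"
      by (auto simp: C_meet_def split: if_splits)
    then show ?thesis
      by (intro exI[of _ "{y}"]) (auto simp: C_meet_def)
  qed
qed

lemma finite_consequence_operator_C_sub:
  assumes "L \<noteq> {}" and "X \<subseteq> L" and "finite Y"
  shows "finite_consequence_operator L (C_sub X Y)"
proof (rule finite_consequence_operatorI[OF consequence_operator_C_sub[OF assms(1,2)]])
  fix Z z assume z: "z \<in> C_sub X Y Z"
  show "\<exists>A. finite A \<and> A \<subseteq> Z \<and> z \<in> C_sub X Y A"
  proof (cases "z \<in> Z")
    case True
    then show ?thesis
      by (intro exI[of _ "{z}"]) (simp add: C_sub_def)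
  next
    case False
    with z have "Y \<subseteq> Z" "z \<in> X"
      by (simp_all add: C_sub_def split: if_splits)
    \<comment> \<open>The least set that triggers the addition of \<open>X\<close> is
      \<open>Y\<close>, so its finiteness makes it the required witness.\<close>
    with \<open>finite Y\<close> show ?thesis
      by (intro exI[of _ Y]) (simp add: C_sub_def)
  qed
qed

theorem theorem2p5:
  fixes L X Y :: "'a set"
  assumes "L \<noteq> {}" and "X \<subseteq> L" and "Y \<subseteq> L"
  shows "finite_consequence_operator L (C_meet X Y) \<and>
         consequence_operator L (C_sub X Y) \<and>
         (finite Y \<longrightarrow> finite_consequence_operator L (C_sub X Y))"
  by (intro conjI impI finite_consequence_operator_C_meet consequence_operator_C_sub
      finite_consequence_operator_C_sub assms(1,2))

end
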